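(* Let $r$ be a positive integer, let $X,Y$ be $r$-sets, and let $i:X'\to X$ and $j:Y'\to Y$ be weak cores. Then $X$ and $Y$ are strongly homotopy equivalent if and only if $X'$ and $Y'$ are isomorphic $r$-sets.
   Context: Fix a positive integer $r$. An $r$-set is a pair $X=(V(X),R(X))$ consisting of a set $V(X)$ (possibly infinite) and a subset $R(X)\subset V(X)^r$. A homomorphism $f:X\to Y$ is a map $f:V(X)\to V(Y)$ with $f^{\times r}(R(X))\subset R(Y)$; isomorphisms are those of the resulting category. A multi-homomorphism from $X$ to $Y$ is a map $\eta:V(X)\to 2^{V(Y)}\setminus\{\emptyset\}$ such that $\eta(x_1)\times\cdots\times\eta(x_r)\subset R(Y)$ for every $(x_1,\dots,x_r)\in R(X)$. $\mathrm{Hom}(X,Y)$ is the poset of all multi-homomorphisms from $X$ to $Y$, ordered by $\eta\le\eta'$ iff $\eta(v)\subset\eta'(v)$ for all $v$. A homomorphism $f$ is identified with the multi-homomorphism $x\mapsto\{f(x)\}$. Homomorphisms $f,g:X\to Y$ are strongly homotopic, $f\sim_s g$, if they lie in the same connected component of the poset $\mathrm{Hom}(X,Y)$ (i.e. are joined by a finite zigzag of comparable elements). A homomorphism $f:X\to Y$ is a strong (homotopy) equivalence if there is a homomorphism $g:Y\to X$ with $gf\sim_s\mathrm{id}_X$ and $fg\sim_s\mathrm{id}_Y$; $X$ and $Y$ are strongly homotopy equivalent if such an $f$ exists. A vertex $x\in V(X)$ is dismantlable if there is $y\in V(X)\setminus\{x\}$ such that for every $i\in\{1,\dots,r\}$ and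 every $(x_1,\dots,x_r)\in R(X)$ with $x_i=x$, one has $(x_1,\dots,x_{i-1},y,x_{i+1},\dots,x_r)\in R(X)$. An $r$-set is stiff if it has no dismantlable vertex. A weak core of $X$ is a homomorphism $i:X'\to X$ that is a strong equivalence with $X'$ stiff. *)

theory Defs
  imports Main "HOL-Library.FuncSet"
begin

text \<open>
  Tuples in \<open>V(X)\<^sup>r\<close> are lists of length \<open>r\<close>, so coordinates are numbered from \<open>0\<close>.
  Maps out of \<open>V(X)\<close> are extensional functions (\<open>\<rightarrow>\<^sub>E\<close>), so that equality of
  HOL functions is equality of maps on \<open>V(X)\<close>.
\<close>

record 'a rset =
  Vert :: "'a set"
  Rel :: "'a list set"

definition is_rset :: "nat \<Rightarrow> 'a rset \<Rightarrow> bool" where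
  "is_rset r X \<longleftrightarrow> Rel X \<subseteq> {xs. length xs = r \<and> set xs \<subseteq> Vert X}"

definition rhom :: "'a rset \<Rightarrow> 'b rset \<Rightarrow> ('a \<Rightarrow> 'b) set" where
  "rhom X Y = {f \<in> Vert X \<rightarrow>\<^sub>E Vert Y. \<forall>xs \<in> Rel X. map f xs \<in> Rel Y}"

abbreviation rid :: "'a rset \<Rightarrow> 'a \<Rightarrow> 'a" where
  "rid X \<equiv> (\<lambda>x \<in> Vert X. x)"

definition risomorphic :: "'a rset \<Rightarrow> 'b rset \<Rightarrow> bool" where
  "risomorphic X Y \<longleftrightarrow>
     (\<exists>f \<in> rhom X Y. \<exists>g \<in> rhom Y X.
        compose (Vert X) g f = rid X \<and> compose (Vert Y) f g = rid Y)"

text \<open>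
  For \<open>xs = [x\<^sub>1, \<dots>, x\<^sub>r]\<close>, the term \<open>listset (map \<eta> xs)\<close> is the
  product \<open>\<eta> x\<^sub>1 \<times> \<dots> \<times> \<eta> x\<^sub>r\<close>.
\<close>

definition multihom :: "'a rset \<Rightarrow> 'b rset \<Rightarrow> ('a \<Rightarrow> 'b set) set" where
  "multihom X Y =
     {\<eta> \<in> Vert X \<rightarrow>\<^sub>E (Pow (Vert Y) - {{}}). \<forall>xs \<in> Rel X. listset (map \<eta> xs) \<subseteq> Rel Y}"

definition multihom_order :: "'a rset \<Rightarrow> 'b rset \<Rightarrow> (('a \<Rightarrow> 'b set) \<times> ('a \<Rightarrow> 'b set)) set" where
  "multihom_order X Y =
     {(\<eta>, \<eta>'). \<eta> \<in> multihom X Y \<and> \<eta>' \<in> multihom X Y \<and> (\<forall>v \<in> Vert X. \<eta> v \<subseteq> \<eta>' v)}"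

definition hom_to_multihom :: "'a rset \<Rightarrow> ('a \<Rightarrow> 'b) \<Rightarrow> 'a \<Rightarrow> 'b set" where
  "hom_to_multihom X f = (\<lambda>x \<in> Vert X. {f x})"

definition strongly_homotopic ::
    "'a rset \<Rightarrow> 'b rset \<Rightarrow> ('a \<Rightarrow> 'b) \<Rightarrow> ('a \<Rightarrow> 'b) \<Rightarrow> bool" where
  "strongly_homotopic X Y f g \<longleftrightarrow>
     f \<in> rhom X Y \<and> g \<in> rhom X Y \<and>
     (hom_to_multihom X f, hom_to_multihom X g)
       \<in> (multihom_order X Y \<union> (multihom_order X Y)\<inverse>)\<^sup>*"

definition strong_equivalence :: "'a rset \<Rightarrow> 'b rset \<Rightarrow> ('a \<Rightarrow> 'b) \<Rightarrow> bool" where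
  "strong_equivalence X Y f \<longleftrightarrow>
     f \<in> rhom X Y \<and>
     (\<exists>g \<in> rhom Y X.
        strongly_homotopic X X (compose (Vert X) g f) (rid X) \<and>
        strongly_homotopic Y Y (compose (Vert Y) f g) (rid Y))"

definition strongly_homotopy_equivalent :: "'a rset \<Rightarrow> 'b rset \<Rightarrow> bool" where
  "strongly_homotopy_equivalent X Y \<longleftrightarrow> (\<exists>f. strong_equivalence X Y f)"

definition dismantlable :: "'a rset \<Rightarrow> 'a \<Rightarrow> bool" where
  "dismantlable X x \<longleftrightarrow>
     x \<in> Vert X \<and>
     (\<exists>y \<in> Vert X - {x}. \<forall>xs \<in> Rel X. \<forall>i < length xs. xs ! i = x \<longrightarrow> xs[i := y] \<in> Rel X)"

definition stiff :: "'a rset \<Rightarrow> bool" where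
  "stiff X \<longleftrightarrow> (\<forall>x \<in> Vert X. \<not> dismantlable X x)"

definition weak_core :: "'a rset \<Rightarrow> 'b rset \<Rightarrow> ('a \<Rightarrow> 'b) \<Rightarrow> bool" where
  "weak_core X' X i \<longleftrightarrow> strong_equivalence X' X i \<and> stiff X'"

end

theory Submission imports Defs begin

text \<open>
  Composition preserves strong homotopy, so strong homotopy equivalence is an equivalence
  relation and \<open>X \<simeq> Y\<close> holds iff \<open>X' \<simeq> Y'\<close>. In a stiff \<open>r\<close>-set the identity is an isolated
  point of the poset \<open>Hom(X, X)\<close>: nothing lies strictly below it because values are non-empty,
  and if \<open>\<eta> \<ge> id\<close> had some \<open>y \<in> \<eta> x\<close> with \<open>y \<noteq> x\<close>, then \<open>y\<close> would dismantle \<open>x\<close>. Hence a strong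
  equivalence between stiff \<open>r\<close>-sets is an isomorphism.
\<close>

section \<open>Products of sets, and composition of homomorphisms\<close>

text \<open>Makes membership in a product a positionwise condition, the form suited to a tuple with
  one entry replaced.\<close>

lemma in_listset_iff_list_all2: "ys \<in> listset As \<longleftrightarrow> list_all2 (\<in>) ys As"
  by (induction As arbitrary: ys) (auto simp: set_Cons_def list_all2_Cons2)

text \<open>For \<open>multihom_postcompose\<close>: a tuple in the product of the image sets lifts
  to a tuple in the product of the original sets.\<close>

lemma listset_map_image: "listset (map (\<lambda>x. h ` A x) xs) = map h ` listset (map A xs)"
proof (induction xs)
  case (Cons a xs)
  have "set_Cons (h ` B) (map h ` C) = map h ` set_Cons B C" for B C
    by (force simp: set_Cons_def)
  then show ?case
    using Cons by simp
qed simp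

lemma is_rset_Rel_subset: "is_rset r X \<Longrightarrow> xs \<in> Rel X \<Longrightarrow> set xs \<subseteq> Vert X"
  by (auto simp: is_rset_def)

text \<open>Maps are built as restrictions to stay extensional; on related tuples the restriction is
  invisible, since all entries are vertices.\<close>

lemma map_restrict_Rel:
  assumes "is_rset r X" "xs \<in> Rel X"
  shows "map (restrict f (Vert X)) xs = map f xs"
  using is_rset_Rel_subset[OF assms] by auto

lemma rhom_mem: "f \<in> rhom X Y \<Longrightarrow> x \<in> Vert X \<Longrightarrow> f x \<in> Vert Y"
  by (auto simp: rhom_def)

lemma rid_in_rhom: "is_rset r X \<Longrightarrow> rid X \<in> rhom X X"
  by (simp add: rhom_def map_restrict_Rel)

lemma compose_in_rhom:
  assumes "is_rset r X" "f \<in> rhom X Y" "g \<in> rhom Y Z"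
  shows "compose (Vert X) g f \<in> rhom X Z"
proof -
  have "map (compose (Vert X) g f) xs \<in> Rel Z" if "xs \<in> Rel X" for xs
  proof -
    have "map (compose (Vert X) g f) xs = map g (map f xs)"
      unfolding compose_def map_restrict_Rel[OF assms(1) that] by simp
    also have "map g (map f xs) \<in> Rel Z"
      using assms(2,3) that unfolding rhom_def by blast
    finally show ?thesis .
  qed
  moreover have "compose (Vert X) g f \<in> Vert X \<rightarrow>\<^sub>E Vert Z"
    using rhom_mem[OF assms(2)] rhom_mem[OF assms(3)] by (auto simp: compose_def)
  ultimately show ?thesis
    by (simp add: rhom_def)
qed

section \<open>Composition acts on multi-homomorphisms and on strong homotopies\<close>

lemma multihom_postcompose:
  assumes "is_rset r X" "h \<in> rhom Y Z" "\<eta> \<in> multihom X Y"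
  shows "(\<lambda>x \<in> Vert X. h ` \<eta> x) \<in> multihom X Z"
proof -
  have "listset (map (\<lambda>x \<in> Vert X. h ` \<eta> x) xs) \<subseteq> Rel Z" if "xs \<in> Rel X" for xs
    unfolding map_restrict_Rel[OF assms(1) that] listset_map_image
    using assms(2,3) that by (fastforce simp: multihom_def rhom_def)
  moreover have "(\<lambda>x \<in> Vert X. h ` \<eta> x) \<in> Vert X \<rightarrow>\<^sub>E Pow (Vert Z) - {{}}"
    using assms rhom_mem[OF assms(2)] by (fastforce simp: multihom_def PiE_iff)
  ultimately show ?thesis
    by (simp add: multihom_def)
qed

text \<open>The product along \<open>ws\<close> is the product of \<open>\<eta>\<close> along
  \<open>map k ws\<close>, again a related tuple.\<close>

lemma multihom_precompose:
  assumes "is_rset r W" "k \<in> rhom W X" "\<eta> \<in> multihom X Y"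
  shows "(\<lambda>w \<in> Vert W. \<eta> (k w)) \<in> multihom W Y"
proof -
  have "listset (map (\<lambda>w \<in> Vert W. \<eta> (k w)) ws) \<subseteq> Rel Y" if "ws \<in> Rel W" for ws
  proof -
    have "map (\<lambda>w \<in> Vert W. \<eta> (k w)) ws = map \<eta> (map k ws)"
      unfolding map_restrict_Rel[OF assms(1) that] by simp
    moreover have "map k ws \<in> Rel X"
      using assms(2) that by (simp add: rhom_def)
    ultimately show ?thesis
      using assms(3) by (simp only: multihom_def mem_Collect_eq)
  qed
  moreover have "(\<lambda>w \<in> Vert W. \<eta> (k w)) \<in> Vert W \<rightarrow>\<^sub>E Pow (Vert Y) - {{}}"
    using assms rhom_mem[OF assms(2)] by (fastforce simp: multihom_def PiE_iff)
  ultimately show ?thesis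
    by (simp add: multihom_def)
qed

text \<open>Stated for arbitrary relations so that it serves composition on either side.\<close>

lemma zigzag_map:
  assumes "(\<eta>, \<theta>) \<in> (r \<union> r\<inverse>)\<^sup>*" and "\<And>a b. (a, b) \<in> r \<Longrightarrow> (F a, F b) \<in> s"
  shows "(F \<eta>, F \<theta>) \<in> (s \<union> s\<inverse>)\<^sup>*"
  using assms(1)
proof (induction rule: rtrancl_induct)
  case (step y z)
  then have "(F y, F z) \<in> s \<union> s\<inverse>"
    using assms(2) by auto
  then show ?case
    using step.IH by (rule rtrancl_into_rtrancl[rotated])
qed simp

lemma strongly_homotopic_trans:
  "strongly_homotopic X Y f g \<Longrightarrow> strongly_homotopic X Y g h \<Longrightarrow> strongly_homotopic X Y f h"
  by (auto simp: strongly_homotopic_def)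

lemma strongly_homotopic_postcompose:
  assumes "is_rset r X" "h \<in> rhom Y Z" "strongly_homotopic X Y f g"
  shows "strongly_homotopic X Z (compose (Vert X) h f) (compose (Vert X) h g)"
proof -
  have zigzag: "(hom_to_multihom X f, hom_to_multihom X g)
      \<in> (multihom_order X Y \<union> (multihom_order X Y)\<inverse>)\<^sup>*"
    using assms(3) by (simp add: strongly_homotopic_def)
  let ?F = "\<lambda>\<eta>. \<lambda>x \<in> Vert X. h ` \<eta> x"
  have mono: "(?F \<eta>, ?F \<theta>) \<in> multihom_order X Z" if "(\<eta>, \<theta>) \<in> multihom_order X Y" for \<eta> \<theta>
    using that multihom_postcompose[OF assms(1,2)] by (auto simp: multihom_order_def)
  \<comment> \<open>\<open>?F\<close> extends composition with \<open>h\<close>: it sends the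
    singleton \<open>{f x}\<close> to \<open>{h (f x)}\<close>.\<close>
  have F: "hom_to_multihom X (compose (Vert X) h f) = ?F (hom_to_multihom X f)" for f
    by (intro ext) (simp add: hom_to_multihom_def compose_def)
  have "(?F (hom_to_multihom X f), ?F (hom_to_multihom X g))
      \<in> (multihom_order X Z \<union> (multihom_order X Z)\<inverse>)\<^sup>*"
    using zigzag mono by (rule zigzag_map)
  then show ?thesis
    using assms(3) compose_in_rhom[OF assms(1) _ assms(2)]
    unfolding strongly_homotopic_def F by blast
qed

lemma strongly_homotopic_precompose:
  assumes "is_rset r W" "k \<in> rhom W X" "strongly_homotopic X Y f g"
  shows "strongly_homotopic W Y (compose (Vert W) f k) (compose (Vert W) g k)"
proof -
  have zigzag: "(hom_to_multihom X f, hom_to_multihom X g)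
      \<in> (multihom_order X Y \<union> (multihom_order X Y)\<inverse>)\<^sup>*"
    using assms(3) by (simp add: strongly_homotopic_def)
  let ?F = "\<lambda>\<eta>. \<lambda>w \<in> Vert W. \<eta> (k w)"
  have mono: "(?F \<eta>, ?F \<theta>) \<in> multihom_order W Y" if "(\<eta>, \<theta>) \<in> multihom_order X Y" for \<eta> \<theta>
    using that multihom_precompose[OF assms(1,2)] rhom_mem[OF assms(2)]
    by (auto simp: multihom_order_def)
  \<comment> \<open>Since \<open>k w\<close> lies in \<open>Vert X\<close>, the restriction in
    \<open>hom_to_multihom X f\<close> evaluates there to \<open>{f (k w)}\<close>.\<close>
  have F: "hom_to_multihom W (compose (Vert W) f k) = ?F (hom_to_multihom X f)" for f
    using rhom_mem[OF assms(2)] by (intro ext) (simp add: hom_to_multihom_def compose_def)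
  have "(?F (hom_to_multihom X f), ?F (hom_to_multihom X g))
      \<in> (multihom_order W Y \<union> (multihom_order W Y)\<inverse>)\<^sup>*"
    using zigzag mono by (rule zigzag_map)
  then show ?thesis
    using assms(3) compose_in_rhom[OF assms(1,2)]
    unfolding strongly_homotopic_def F by blast
qed

section \<open>Strong homotopy equivalence as an equivalence relation\<close>

text \<open>The composite contracts from the inside: the homotopy from \<open>g' f'\<close> to the
  identity, sandwiched between \<open>g\<close> and \<open>f\<close>, leaves \<open>g f\<close>,
  which is homotopic to the identity.\<close>

lemma strongly_homotopic_cancel_middle:
  assumes "is_rset r X" "is_rset r Y"
    and "f \<in> rhom X Y" "g \<in> rhom Y X" "f' \<in> rhom Y Z" "g' \<in> rhom Z Y"
    and "strongly_homotopic X X (compose (Vert X) g f) (rid X)"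
    and "strongly_homotopic Y Y (compose (Vert Y) g' f') (rid Y)"
  shows "strongly_homotopic X X
    (compose (Vert X) (compose (Vert Z) g g') (compose (Vert X) f' f)) (rid X)"
proof -
  have "strongly_homotopic X X
      (compose (Vert X) g (compose (Vert X) (compose (Vert Y) g' f') f))
      (compose (Vert X) g (compose (Vert X) (rid Y) f))"
    using strongly_homotopic_postcompose[OF assms(1,4)
        strongly_homotopic_precompose[OF assms(1,3,8)]] .
  moreover have "compose (Vert X) (compose (Vert Z) g g') (compose (Vert X) f' f)
      = compose (Vert X) g (compose (Vert X) (compose (Vert Y) g' f') f)"
    using rhom_mem[OF assms(3)] rhom_mem[OF assms(5)] by (auto simp: compose_def)
  moreover have "compose (Vert X) g (compose (Vert X) (rid Y) f) = compose (Vert X) g f"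
    using rhom_mem[OF assms(3)] by (auto simp: compose_def)
  ultimately show ?thesis
    using assms(7) by (simp add: strongly_homotopic_trans)
qed

lemma strongly_homotopy_equivalent_sym:
  "strongly_homotopy_equivalent X Y \<Longrightarrow> strongly_homotopy_equivalent Y X"
  by (auto simp: strongly_homotopy_equivalent_def strong_equivalence_def)

lemma strongly_homotopy_equivalent_trans:
  assumes "is_rset r X" "is_rset r Y" "is_rset r Z"
    and "strongly_homotopy_equivalent X Y" "strongly_homotopy_equivalent Y Z"
  shows "strongly_homotopy_equivalent X Z"
proof -
  obtain f g where f: "f \<in> rhom X Y" "g \<in> rhom Y X"
    "strongly_homotopic X X (compose (Vert X) g f) (rid X)"
    "strongly_homotopic Y Y (compose (Vert Y) f g) (rid Y)"
    using assms(4) by (auto simp: strongly_homotopy_equivalent_def strong_equivalence_def)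
  obtain f' g' where f': "f' \<in> rhom Y Z" "g' \<in> rhom Z Y"
    "strongly_homotopic Y Y (compose (Vert Y) g' f') (rid Y)"
    "strongly_homotopic Z Z (compose (Vert Z) f' g') (rid Z)"
    using assms(5) by (auto simp: strongly_homotopy_equivalent_def strong_equivalence_def)
  \<comment> \<open>The witnesses are \<open>f' f\<close> and \<open>g g'\<close>. The composite on
    \<open>Z\<close> is handled by the same lemma, run from \<open>Z\<close> through
    \<open>Y\<close> to \<open>X\<close>.\<close>
  show ?thesis
    unfolding strongly_homotopy_equivalent_def strong_equivalence_def
    using compose_in_rhom[OF assms(1) f(1) f'(1)] compose_in_rhom[OF assms(3) f'(2) f(2)]
      strongly_homotopic_cancel_middle[OF assms(1,2) f(1,2) f'(1,2) f(3) f'(3)]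
      strongly_homotopic_cancel_middle[OF assms(3,2) f'(2,1) f(2,1) f'(4) f(4)]
    by blast
qed

text \<open>Mutually inverse homomorphisms compose to the identities, so zigzags of length zero
  suffice.\<close>

lemma risomorphic_imp_strongly_homotopy_equivalent:
  assumes "is_rset r X" "is_rset r Y" "risomorphic X Y"
  shows "strongly_homotopy_equivalent X Y"
proof -
  have "strongly_homotopic X X (rid X) (rid X)" "strongly_homotopic Y Y (rid Y) (rid Y)"
    using assms rid_in_rhom by (auto simp: strongly_homotopic_def)
  then show ?thesis
    using assms(3)
    unfolding risomorphic_def strongly_homotopy_equivalent_def strong_equivalence_def
    by metis
qed

section \<open>Rigidity of stiff \<open>r\<close>-sets\<close>

lemma stiff_multihom_above_rid:
  assumes X: "is_rset r X" "stiff X"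
    and le: "(hom_to_multihom X (rid X), \<eta>) \<in> multihom_order X X"
  shows "\<eta> = hom_to_multihom X (rid X)"
proof -
  have \<eta>: "\<eta> \<in> multihom X X" and self: "\<And>x. x \<in> Vert X \<Longrightarrow> x \<in> \<eta> x"
    using le by (auto simp: multihom_order_def hom_to_multihom_def)
  have "y = x" if x: "x \<in> Vert X" and y: "y \<in> \<eta> x" for x y
  proof (rule ccontr)
    assume "y \<noteq> x"
    moreover have "y \<in> Vert X"
      using \<eta> x y by (auto simp: multihom_def)
    moreover have "xs[k := y] \<in> Rel X" if "xs \<in> Rel X" "k < length xs" "xs ! k = x" for xs k
    proof -
      \<comment> \<open>Position \<open>k\<close> uses \<open>y \<in> \<eta> x\<close>; every other
        position, including further occurrences of \<open>x\<close>, uses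
        \<open>self\<close>.\<close>
      have "list_all2 (\<in>) (xs[k := y]) (map \<eta> xs)"
        unfolding list_all2_conv_all_nth
      proof (intro conjI allI impI)
        fix m assume "m < length (xs[k := y])"
        then have m: "m < length xs" "xs ! m \<in> Vert X"
          using is_rset_Rel_subset[OF X(1) that(1)] by auto
        show "xs[k := y] ! m \<in> map \<eta> xs ! m"
          using m self[OF m(2)] that y by (cases "m = k") auto
      qed simp
      then show ?thesis
        using \<eta> that(1) by (auto simp: multihom_def simp flip: in_listset_iff_list_all2)
    qed
    ultimately have "dismantlable X x"
      using x by (auto simp: dismantlable_def)
    then show False
      using X(2) x by (auto simp: stiff_def)
  qed
  then have "\<eta> x = hom_to_multihom X (rid X) x" if "x \<in> Vert X" for x
    using that self by (auto simp: hom_to_multihom_def)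
  moreover have "\<eta> \<in> extensional (Vert X)"
    using \<eta> by (simp add: multihom_def PiE_def)
  ultimately show ?thesis
    by (intro extensionalityI[of _ "Vert X"]) (auto simp: hom_to_multihom_def)
qed

text \<open>Each value is a non-empty subset of a singleton, hence that singleton.\<close>

lemma multihom_below_rid:
  assumes "(\<eta>, hom_to_multihom X (rid X)) \<in> multihom_order X X"
  shows "\<eta> = hom_to_multihom X (rid X)"
proof -
  have \<eta>: "\<eta> \<in> Vert X \<rightarrow>\<^sub>E Pow (Vert X) - {{}}" "\<And>x. x \<in> Vert X \<Longrightarrow> \<eta> x \<subseteq> {x}"
    using assms by (auto simp: multihom_order_def multihom_def hom_to_multihom_def)
  have "\<eta> x = hom_to_multihom X (rid X) x" if "x \<in> Vert X" for x
    using \<eta>(2)[OF that] PiE_mem[OF \<eta>(1) that] that by (auto simp: hom_to_multihom_def)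
  moreover have "\<eta> \<in> extensional (Vert X)"
    using \<eta>(1) by (simp add: PiE_def)
  ultimately show ?thesis
    by (intro extensionalityI[of _ "Vert X"]) (auto simp: hom_to_multihom_def)
qed

lemma stiff_strongly_homotopic_rid:
  assumes "is_rset r X" "stiff X" "strongly_homotopic X X f (rid X)"
  shows "f = rid X"
proof -
  have "(hom_to_multihom X f, hom_to_multihom X (rid X))
      \<in> (multihom_order X X \<union> (multihom_order X X)\<inverse>)\<^sup>*"
    using assms(3) by (simp add: strongly_homotopic_def)
  then have "hom_to_multihom X f = hom_to_multihom X (rid X)"
  \<comment> \<open>The zigzag is read backwards from the identity: \<open>\<theta>\<close> equals
    it by the induction hypothesis, and \<open>\<eta>\<close> is comparable to
    \<open>\<theta>\<close>, so it cannot leave that point.\<close>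
  proof (induction rule: converse_rtrancl_induct)
    case (step \<eta> \<theta>)
    then show ?case
      using stiff_multihom_above_rid[OF assms(1,2)] multihom_below_rid by blast
  qed (rule refl)
  then have "f x = x" if "x \<in> Vert X" for x
    using that by (metis hom_to_multihom_def restrict_apply' singleton_inject)
  moreover have "f \<in> extensional (Vert X)"
    using assms(3) by (simp add: strongly_homotopic_def rhom_def PiE_def)
  ultimately show ?thesis
    by (intro extensionalityI[of _ "Vert X"]) auto
qed

text \<open>Stiffness turns both homotopies to the identity into equations, so a homotopy inverse is
  a genuine inverse.\<close>

lemma stiff_strongly_homotopy_equivalent_iff_risomorphic:
  assumes "is_rset r X" "is_rset r Y" "stiff X" "stiff Y"
  shows "strongly_homotopy_equivalent X Y \<longleftrightarrow> risomorphic X Y"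
proof
  assume "strongly_homotopy_equivalent X Y"
  then show "risomorphic X Y"
    using stiff_strongly_homotopic_rid[OF assms(1,3)] stiff_strongly_homotopic_rid[OF assms(2,4)]
    unfolding risomorphic_def strongly_homotopy_equivalent_def strong_equivalence_def
    by blast
qed (rule risomorphic_imp_strongly_homotopy_equivalent[OF assms(1,2)])

theorem theorem5p15:
  fixes r :: nat
    and X :: "'a rset" and Y :: "'b rset"
    and X' :: "'c rset" and Y' :: "'d rset"
    and i :: "'c \<Rightarrow> 'a" and j :: "'d \<Rightarrow> 'b"
  assumes "r > 0"
    and "is_rset r X" and "is_rset r Y"
    and "is_rset r X'" and "is_rset r Y'"
    and "weak_core X' X i" and "weak_core Y' Y j"
  shows "strongly_homotopy_equivalent X Y \<longleftrightarrow> risomorphic X' Y'"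
proof -
  note sets = assms(2-5)
  have cores: "strongly_homotopy_equivalent X' X" "strongly_homotopy_equivalent Y' Y"
    and stiff: "stiff X'" "stiff Y'"
    using assms(6,7) by (auto simp: weak_core_def strongly_homotopy_equivalent_def)
  \<comment> \<open>The cores give the chain \<open>X'\<close>, \<open>X\<close>, \<open>Y\<close>,
    \<open>Y'\<close> for one direction and \<open>X\<close>, \<open>X'\<close>, \<open>Y'\<close>,
    \<open>Y\<close> for the other.\<close>
  have "strongly_homotopy_equivalent X Y \<longleftrightarrow> strongly_homotopy_equivalent X' Y'"
  proof
    assume "strongly_homotopy_equivalent X Y"
    then have "strongly_homotopy_equivalent X' Y"
      by (rule strongly_homotopy_equivalent_trans[OF sets(3,1,2) cores(1)])
    then show "strongly_homotopy_equivalent X' Y'"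
      using strongly_homotopy_equivalent_sym[OF cores(2)]
      by (rule strongly_homotopy_equivalent_trans[OF sets(3,2,4)])
  next
    assume "strongly_homotopy_equivalent X' Y'"
    then have "strongly_homotopy_equivalent X Y'"
      by (rule strongly_homotopy_equivalent_trans[OF sets(1,3,4)
            strongly_homotopy_equivalent_sym[OF cores(1)]])
    then show "strongly_homotopy_equivalent X Y"
      using cores(2) by (rule strongly_homotopy_equivalent_trans[OF sets(1,4,2)])
  qed
  then show ?thesis
    using stiff_strongly_homotopy_equivalent_iff_risomorphic[OF sets(3,4) stiff] by simp
qed

end
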